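(* Let $\mathcal{G}$ be a finite DAG and let $f\colon V(\mathcal{G})\to\mathbb{R}$ be a non-monotone function. Then for some $k\ge1$ there exist Boolean functions $f_1,\dots,f_k\colon V(\mathcal{G})\to\{0,1\}$ and pairwise vertex-disjoint induced subgraphs $\mathcal{H}_1,\dots,\mathcal{H}_k$ of $\mathcal{G}$ such that: (1) $2\sum_{i=1}^k\varepsilon(f_i)\ge\varepsilon(f)$; (2) $\mathcal{S}^-_{f_i}\subseteq\mathcal{S}^-_f\cap E(\mathcal{H}_i)$ for all $i\in[k]$.
   Context: A DAG $\mathcal{G}$ induces a partial order on $V(\mathcal{G})$: $x\preceq y$ iff $\mathcal{G}$ contains a directed path from $x$ to $y$. A function $g\colon V(\mathcal{G})\to\mathbb{R}$ is monotone if $g(x)\le g(y)$ whenever $x\preceq y$. The distance to monotonicity $\varepsilon(g)$ is the minimum, over monotone $h\colon V(\mathcal{G})\to\mathbb{R}$, of the fraction of vertices $x$ with $g(x)\ne h(x)$. An edge $(x,y)\in E(\mathcal{G})$ is violated by $g$ if $g(x)>g(y)$; $\mathcal{S}^-_g$ is the set of edges of $\mathcal{G}$ violated by $g$. *)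

theory Defs
  imports Complex_Main "HOL-Library.Disjoint_Sets" "Graph_Theory.Digraph_Component"
begin

text \<open>
  Edges are ordered pairs of vertices (\<open>pair_pre_digraph\<close>), so \<open>pverts G\<close> and \<open>parcs G\<close> are
  \<open>V(G)\<close> and \<open>E(G)\<close>; \<open>pair_digraph\<close> includes finiteness.
  A real function on \<open>V(G)\<close> is a total function of type \<open>'a \<Rightarrow> real\<close>; no definition below
  depends on its values outside \<open>pverts G\<close>.
\<close>

locale fin_dag = pair_digraph G for G :: "'a pair_pre_digraph" +
  assumes acyclic: "\<not> (\<exists>p. cycle p)"

definition dag_le :: "'a pair_pre_digraph \<Rightarrow> 'a \<Rightarrow> 'a \<Rightarrow> bool" where
  "dag_le G x y \<longleftrightarrow> x \<rightarrow>\<^sup>*\<^bsub>with_proj G\<^esub> y"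

definition dag_mono :: "'a pair_pre_digraph \<Rightarrow> ('a \<Rightarrow> real) \<Rightarrow> bool" where
  "dag_mono G g \<longleftrightarrow> monotone_on (pverts G) (dag_le G) (\<le>) g"

definition diff_fraction :: "'a pair_pre_digraph \<Rightarrow> ('a \<Rightarrow> real) \<Rightarrow> ('a \<Rightarrow> real) \<Rightarrow> real" where
  "diff_fraction G g h = real (card {x \<in> pverts G. g x \<noteq> h x}) / real (card (pverts G))"

definition mono_dist :: "'a pair_pre_digraph \<Rightarrow> ('a \<Rightarrow> real) \<Rightarrow> real" where
  "mono_dist G g = Min (diff_fraction G g ` {h. dag_mono G h})"

definition violated :: "'a pair_pre_digraph \<Rightarrow> ('a \<Rightarrow> real) \<Rightarrow> ('a \<times> 'a) set" where
  "violated G g = {(x, y). (x, y) \<in> parcs G \<and> g x > g y}"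

text \<open>The minimum is over a finite nonempty set of values, although there are infinitely many \<open>h\<close>.\<close>

lemma (in fin_dag) mono_dist_values:
  "finite (diff_fraction G g ` {h. dag_mono G h})"
  "diff_fraction G g ` {h. dag_mono G h} \<noteq> {}"
proof -
  have "diff_fraction G g ` {h. dag_mono G h}
      \<subseteq> (\<lambda>A. real (card A) / real (card (pverts G))) ` Pow (pverts G)"
    by (auto simp: diff_fraction_def)
  then show "finite (diff_fraction G g ` {h. dag_mono G h})"
    using pair_finite_verts by (meson finite_Pow_iff finite_imageI finite_subset)
  have "dag_mono G (\<lambda>_. 0)"
    by (simp add: dag_mono_def monotone_on_def)
  then show "diff_fraction G g ` {h. dag_mono G h} \<noteq> {}"
    by blast
qed

end

theory Submission
  imports Defs "HOL-Combinatorics.Cycles"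
begin

text \<open>
  Among all matchings of comparable pairs \<open>x \<preceq> y\<close> take one, \<open>M\<close>, of maximum weight \<open>\<Sum>(f x - f y)\<close>,
  and of minimum cardinality among those. Then every pair of \<open>M\<close> is violated, and \<open>M\<close> is a maximal
  matching of violated pairs, so \<open>f\<close> becomes monotone after removing at most \<open>2|M|\<close> vertices.
  Draw an arc from \<open>(x, y)\<close> to \<open>(x', y')\<close> when \<open>x \<preceq> y'\<close>. Shifting the partners along a cycle of this
  digraph on \<open>M\<close> changes neither weight nor cardinality, hence again gives an optimal matching; so
  \<open>f x > f y'\<close> whenever \<open>(x, y)\<close> and \<open>(x', y')\<close> lie in the same strongly connected component and
  \<open>x \<preceq> y'\<close>. For a component \<open>C\<close> let \<open>H\<^sub>C\<close> be spanned by the vertices lying between a lower and an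
  upper endpoint of \<open>C\<close>; these sets are disjoint for distinct components. The Boolean function of
  \<open>C\<close> compares \<open>f z\<close> on \<open>H\<^sub>C\<close> with the values of \<open>f\<close> at the upper endpoints above \<open>z\<close>, and off
  \<open>H\<^sub>C\<close> it indicates the vertices above a lower endpoint. It violates all pairs of \<open>C\<close>, so its
  distance to monotonicity is at least \<open>|C| / n\<close>.
\<close>

section \<open>Cyclic shifts along a walk\<close>

text \<open>Loop erasure: if the new first point already occurs in the list, only the suffix
  starting there is kept.\<close>

lemma rtrancl_imp_distinct_list:
  assumes "(a, b) \<in> r\<^sup>*"
  shows "\<exists>cs. cs \<noteq> [] \<and> distinct cs \<and> hd cs = a \<and> last cs = b
    \<and> successively (\<lambda>x y. (x, y) \<in> r) cs \<and> set cs \<subseteq> insert b (Domain r)"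
  using assms
proof (induction rule: converse_rtrancl_induct)
  case base
  show ?case by (intro exI[of _ "[b]"]) auto
next
  case (step a a')
  then obtain cs where cs: "cs \<noteq> []" "distinct cs" "hd cs = a'" "last cs = b"
    "successively (\<lambda>x y. (x, y) \<in> r) cs" "set cs \<subseteq> insert b (Domain r)"
    by blast
  show ?case
  proof (cases "a \<in> set cs")
    case True
    then obtain us vs where "cs = us @ a # vs" by (meson split_list)
    with cs show ?thesis
      by (intro exI[of _ "a # vs"]) (auto simp: successively_append_iff)
  next
    case False
    with cs step(1) show ?thesis
      by (intro exI[of _ "a # cs"]) (auto simp: successively_Cons)
  qed
qed

text \<open>A simple path from \<open>q\<close> to \<open>p\<close> is closed up to a cycle. The
  closing step from \<open>p\<close> to \<open>q\<close> need not lie in \<open>r\<close>, hence the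
  exception at \<open>p\<close>.\<close>

lemma rtrancl_imp_permutation:
  assumes "(q, p) \<in> r\<^sup>*" "r \<subseteq> M \<times> M" "p \<in> M"
  shows "\<exists>\<sigma>. \<sigma> permutes M \<and> \<sigma> p = q \<and> (\<forall>x\<in>M. x \<noteq> p \<longrightarrow> \<sigma> x = x \<or> (x, \<sigma> x) \<in> r)"
proof -
  obtain cs where cs: "cs \<noteq> []" "distinct cs" "hd cs = q" "last cs = p"
    "successively (\<lambda>x y. (x, y) \<in> r) cs" "set cs \<subseteq> insert p (Domain r)"
    using rtrancl_imp_distinct_list[OF assms(1)] by blast
  let ?\<sigma> = "cycle_of_list cs"
  have "set cs \<subseteq> M" using cs(6) assms(2,3) by auto
  then have perm: "?\<sigma> permutes M"
    using cycle_permutes permutes_subset by blast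
  have "map ?\<sigma> cs = rotate1 cs"
    using cyclic_rotation[OF cs(2), of 1] by simp
  then have nth: "?\<sigma> (cs ! i) = cs ! (Suc i mod length cs)" if "i < length cs" for i
    using that by (metis nth_map nth_rotate1)
  have "?\<sigma> p = q"
    using nth[of "length cs - 1"] cs by (simp add: last_conv_nth hd_conv_nth)
  moreover have "?\<sigma> x = x \<or> (x, ?\<sigma> x) \<in> r" if "x \<noteq> p" for x
  proof (cases "x \<in> set cs")
    case True
    then obtain i where i: "i < length cs" "x = cs ! i" by (metis in_set_conv_nth)
    have "i \<noteq> length cs - 1" using i that cs by (auto simp: last_conv_nth)
    then have "Suc i < length cs" using i by simp
    then show ?thesis
      using nth[of i] i cs(5) by (simp add: successively_conv_nth)
  qed (simp add: id_outside_supp)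
  ultimately show ?thesis using perm by blast
qed

section \<open>Optimal matchings of comparable pairs\<close>

locale finite_preorder =
  fixes V :: "'a set" and le :: "'a \<Rightarrow> 'a \<Rightarrow> bool" (infix \<open>\<preceq>\<close> 50)
  assumes finite_V: "finite V"
    and le_refl: "x \<in> V \<Longrightarrow> x \<preceq> x"
    and le_trans: "x \<preceq> y \<Longrightarrow> y \<preceq> z \<Longrightarrow> x \<preceq> z"
begin

text \<open>A matching between two copies of \<open>V\<close>: a vertex may be first in one pair and
  second in another, and pairs \<open>(x, x)\<close> are allowed. This freedom keeps shifted
  matchings within the notion.\<close>

definition matching :: "('a \<times> 'a) set \<Rightarrow> bool" where
  "matching M \<longleftrightarrow> M \<subseteq> V \<times> V \<and> inj_on fst M \<and> inj_on snd M \<and> (\<forall>p\<in>M. fst p \<preceq> snd p)"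

definition weight :: "('a \<Rightarrow> real) \<Rightarrow> ('a \<times> 'a) set \<Rightarrow> real" where
  "weight f M = (\<Sum>p\<in>M. f (fst p) - f (snd p))"

definition optimal :: "('a \<Rightarrow> real) \<Rightarrow> ('a \<times> 'a) set \<Rightarrow> bool" where
  "optimal f M \<longleftrightarrow> matching M \<and> (\<forall>N. matching N \<longrightarrow>
     weight f N \<le> weight f M \<and> (weight f N = weight f M \<longrightarrow> card M \<le> card N))"

lemma matching_finite: "matching M \<Longrightarrow> finite M"
  unfolding matching_def using finite_V by (meson finite_SigmaI finite_subset)

lemma ex_optimal: "\<exists>M. optimal f M"
proof -
  let ?N = "Collect matching"
  have fin: "finite ?N"
    by (rule finite_subset[of _ "Pow (V \<times> V)"]) (auto simp: matching_def finite_V)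
  have "matching {}" by (simp add: matching_def)
  then have ne: "?N \<noteq> {}" by blast
  define W where "W = {M \<in> ?N. weight f M = Max (weight f ` ?N)}"
  have "Max (weight f ` ?N) \<in> weight f ` ?N"
    using fin ne by (intro Max_in) auto
  then have "W \<noteq> {}" unfolding W_def by force
  then obtain M where M: "M \<in> W" "\<And>N. N \<in> W \<Longrightarrow> card M \<le> card N"
    using ex_has_least_nat[of "\<lambda>N. N \<in> W" _ card] by blast
  have "optimal f M"
    unfolding optimal_def
  proof (intro conjI allI impI)
    show "matching M" using M(1) by (simp add: W_def)
    fix N assume N: "matching N"
    show "weight f N \<le> weight f M" using N M(1) fin by (simp add: W_def)
    show "card M \<le> card N" if "weight f N = weight f M"
      using M N that by (simp add: W_def)
  qed
  then show ?thesis ..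
qed

lemma optimal_matching: "optimal f M \<Longrightarrow> matching M"
  by (simp add: optimal_def)

text \<open>Dropping a pair of nonpositive weight would not lower the weight but would lower the
  cardinality; the tie-break thus gives strictness.\<close>

lemma optimal_violated:
  assumes "optimal f M" "p \<in> M"
  shows "f (snd p) < f (fst p)"
proof (rule ccontr)
  assume neg: "\<not> f (snd p) < f (fst p)"
  have M: "matching M" using assms(1) by (rule optimal_matching)
  then have N: "matching (M - {p})" by (auto simp: matching_def intro: inj_on_subset)
  have "weight f M = (f (fst p) - f (snd p)) + weight f (M - {p})"
    unfolding weight_def using matching_finite[OF M] assms(2) by (rule sum.remove)
  moreover have "weight f (M - {p}) \<le> weight f M"
    "weight f (M - {p}) = weight f M \<longrightarrow> card M \<le> card (M - {p})"
    using assms(1) N by (simp_all add: optimal_def)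
  ultimately have "card M \<le> card (M - {p})" using neg by linarith
  then show False using card_Diff1_less[OF matching_finite[OF M] assms(2)] by simp
qed

lemma optimal_maximal:
  assumes opt: "optimal f M" and uv: "u \<in> V" "v \<in> V" "u \<preceq> v"
    and "u \<notin> fst ` M \<union> snd ` M" "v \<notin> fst ` M \<union> snd ` M"
  shows "f u \<le> f v"
proof -
  have M: "matching M" using opt by (rule optimal_matching)
  have notin: "(u, v) \<notin> M" using assms(5) by force
  have "matching (insert (u, v) M)"
    using M assms notin by (auto simp: matching_def)
  then have "weight f (insert (u, v) M) \<le> weight f M"
    using opt by (simp add: optimal_def)
  then show ?thesis
    using notin matching_finite[OF M] by (simp add: weight_def)
qed

text \<open>Only the pairing changes, not the sets of first and second coordinates, so the weight is
  the same sum rearranged.\<close>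

lemma optimal_shift:
  assumes opt: "optimal f M" and \<sigma>: "\<sigma> permutes M"
    and le: "\<And>p. p \<in> M \<Longrightarrow> fst p \<preceq> snd (\<sigma> p)"
  shows "optimal f ((\<lambda>p. (fst p, snd (\<sigma> p))) ` M)" (is "optimal f (?s ` M)")
proof -
  have M: "matching M" using opt by (rule optimal_matching)
  have \<sigma>M: "\<sigma> p \<in> M" if "p \<in> M" for p
    using permutes_in_image[OF \<sigma>] that by blast
  have inj: "inj_on fst M" "inj_on snd M" using M by (auto simp: matching_def)
  have inj': "inj_on (\<lambda>p. snd (\<sigma> p)) M"
    using comp_inj_on[of \<sigma> M snd] permutes_inj_on[OF \<sigma>] permutes_image[OF \<sigma>] inj(2)
    by (simp add: comp_def)
  have injs: "inj_on ?s M" using inj(1) by (auto simp: inj_on_def)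
  have "matching (?s ` M)"
    unfolding matching_def
  proof (intro conjI)
    show "?s ` M \<subseteq> V \<times> V" using M \<sigma>M by (fastforce simp: matching_def)
    show "inj_on fst (?s ` M)" using inj(1) by (auto simp: inj_on_def)
    show "inj_on snd (?s ` M)" using inj' by (auto simp: inj_on_def)
    show "\<forall>p\<in>?s ` M. fst p \<preceq> snd p" using le by auto
  qed
  moreover have "weight f (?s ` M) = weight f M"
  proof -
    have "weight f (?s ` M) = (\<Sum>p\<in>M. f (fst p)) - (\<Sum>p\<in>M. f (snd (\<sigma> p)))"
      unfolding weight_def by (simp add: sum.reindex[OF injs] sum_subtractf)
    also have "(\<Sum>p\<in>M. f (snd (\<sigma> p))) = (\<Sum>p\<in>M. f (snd p))"
      using sum.permute[OF \<sigma>, of "\<lambda>p. f (snd p)"] by (simp add: comp_def)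
    finally show ?thesis by (simp add: weight_def sum_subtractf)
  qed
  moreover have "card (?s ` M) = card M" by (rule card_image[OF injs])
  ultimately show ?thesis using opt by (simp add: optimal_def)
qed

section \<open>Components of the matching\<close>

definition link :: "('a \<times> 'a) set \<Rightarrow> (('a \<times> 'a) \<times> ('a \<times> 'a)) set" where
  "link M = {(p, q). p \<in> M \<and> q \<in> M \<and> fst p \<preceq> snd q}"

definition linked :: "('a \<times> 'a) set \<Rightarrow> (('a \<times> 'a) \<times> ('a \<times> 'a)) set" where
  "linked M = {(p, q). p \<in> M \<and> q \<in> M \<and> (p, q) \<in> (link M)\<^sup>* \<and> (q, p) \<in> (link M)\<^sup>*}"

lemma equiv_linked: "equiv M (linked M)"
proof (rule equivI)
  show "trans (linked M)"
    unfolding linked_def trans_def by (blast intro: rtrancl_trans)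
qed (auto simp: linked_def refl_on_def sym_def)

text \<open>The arc from \<open>p\<close> to \<open>q\<close> closes the walk back to a cycle.
  Shifting along it puts \<open>(fst p, snd q)\<close> into another optimal matching, whose pairs
  are all violated.\<close>

lemma link_cycle_violated:
  assumes opt: "optimal f M" and pq: "(p, q) \<in> link M" and qp: "(q, p) \<in> (link M)\<^sup>*"
  shows "f (snd q) < f (fst p)"
proof -
  have M: "matching M" using opt by (rule optimal_matching)
  have pM: "p \<in> M" using pq by (simp add: link_def)
  obtain \<sigma> where \<sigma>: "\<sigma> permutes M" "\<sigma> p = q"
    "\<forall>x\<in>M. x \<noteq> p \<longrightarrow> \<sigma> x = x \<or> (x, \<sigma> x) \<in> link M"
    using rtrancl_imp_permutation[OF qp _ pM] by (auto simp: link_def)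
  have "fst x \<preceq> snd (\<sigma> x)" if "x \<in> M" for x
    using \<sigma>(2,3) that pq M by (cases "x = p") (force simp: link_def matching_def)+
  from optimal_violated[OF optimal_shift[OF opt \<sigma>(1) this], of "(fst p, snd q)"]
  show ?thesis using pM \<sigma>(2) by auto
qed

lemma class_violated:
  assumes opt: "optimal f M" and C: "C \<in> M // linked M" "p \<in> C" "q \<in> C" and le: "fst p \<preceq> snd q"
  shows "f (snd q) < f (fst p)"
proof -
  have "(p, q) \<in> linked M"
    using quotient_eq_iff[OF equiv_linked C(1) C(1) C(2,3)] by simp
  then show ?thesis
    using link_cycle_violated[OF opt, of p q] le by (simp add: linked_def link_def)
qed

definition sweep :: "('a \<times> 'a) set \<Rightarrow> 'a set" where
  "sweep C = {z \<in> V. \<exists>p\<in>C. \<exists>q\<in>C. fst p \<preceq> z \<and> z \<preceq> snd q}"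

text \<open>A common vertex \<open>z\<close> yields cross arcs \<open>a -> d\<close> and
  \<open>c -> b\<close>; with the walks \<open>d -> c\<close> and \<open>b -> a\<close> inside the
  components they form a closed walk.\<close>

lemma sweep_disjoint:
  assumes C: "C \<in> M // linked M" and D: "D \<in> M // linked M" and z: "z \<in> sweep C" "z \<in> sweep D"
  shows "C = D"
proof -
  obtain a b where ab: "a \<in> C" "b \<in> C" "fst a \<preceq> z" "z \<preceq> snd b"
    using z(1) by (auto simp: sweep_def)
  obtain c d where cd: "c \<in> D" "d \<in> D" "fst c \<preceq> z" "z \<preceq> snd d"
    using z(2) by (auto simp: sweep_def)
  have "(b, a) \<in> linked M" "(d, c) \<in> linked M"
    using quotient_eq_iff[OF equiv_linked] C D ab cd by blast+
  moreover have "a \<in> M" "b \<in> M" "c \<in> M" "d \<in> M"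
    using ab cd in_quotient_imp_subset[OF equiv_linked C] in_quotient_imp_subset[OF equiv_linked D]
    by blast+
  moreover from this have "(a, d) \<in> link M" "(c, b) \<in> link M"
    using le_trans[OF ab(3) cd(4)] le_trans[OF cd(3) ab(4)] by (simp_all add: link_def)
  ultimately have "(a, c) \<in> linked M"
    unfolding linked_def by (blast intro: rtrancl_trans converse_rtrancl_into_rtrancl)
  then show ?thesis
    using quotient_eq_iff[OF equiv_linked C D ab(1) cd(1)] by simp
qed

text \<open>A vertex of \<open>V\<close> off the sweep but above a lower endpoint has no upper
  endpoint of \<open>C\<close> above it, so its value 1 continues the first condition
  vacuously.\<close>

definition level :: "('a \<Rightarrow> real) \<Rightarrow> ('a \<times> 'a) set \<Rightarrow> 'a \<Rightarrow> real" where
  "level f C z = of_bool (if z \<in> sweep C then \<forall>q\<in>C. z \<preceq> snd q \<longrightarrow> f (snd q) < f z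
     else \<exists>p\<in>C. fst p \<preceq> z)"

lemma level_decreasing:
  assumes xy: "x \<in> V" "y \<in> V" "x \<preceq> y" and gt: "level f C x > level f C y"
  shows "x \<in> sweep C \<and> y \<in> sweep C \<and> f x > f y"
proof -
  have lx: "if x \<in> sweep C then \<forall>q\<in>C. x \<preceq> snd q \<longrightarrow> f (snd q) < f x else \<exists>p\<in>C. fst p \<preceq> x"
    and ly: "\<not> (if y \<in> sweep C then \<forall>q\<in>C. y \<preceq> snd q \<longrightarrow> f (snd q) < f y else \<exists>p\<in>C. fst p \<preceq> y)"
    using gt unfolding level_def by (auto simp only: of_bool_def split: if_split_asm)
  have "\<exists>p\<in>C. fst p \<preceq> x" using lx by (auto simp: sweep_def split: if_split_asm)
  then obtain p where p: "p \<in> C" "fst p \<preceq> x" by blast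
  \<comment> \<open>Off the sweep, \<open>y\<close> would inherit the value 1, being above
    \<open>fst p\<close> too.\<close>
  then have y: "y \<in> sweep C" using ly xy(3) le_trans by (metis)
  then obtain q where q: "q \<in> C" "y \<preceq> snd q" "\<not> f (snd q) < f y" using ly by auto
  \<comment> \<open>The witness \<open>q\<close> for the value 0 at \<open>y\<close> also lies above
    \<open>x\<close>, so \<open>f y \<le> f (snd q) < f x\<close>.\<close>
  have "x \<preceq> snd q" using q(2) xy(3) le_trans by blast
  moreover from this have x: "x \<in> sweep C" using p q(1) xy(1) by (auto simp: sweep_def)
  ultimately have "f (snd q) < f x" using lx q(1) by simp
  then show ?thesis using x y q(3) by simp
qed

text \<open>At \<open>fst p\<close> this is \<open>class_violated\<close>; at \<open>snd p\<close>
  the strict comparison fails for \<open>p\<close> itself.\<close>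

lemma level_endpoints:
  assumes opt: "optimal f M" and C: "C \<in> M // linked M" and p: "p \<in> C"
  shows "level f C (fst p) = 1" "level f C (snd p) = 0"
proof -
  have "p \<in> M" using in_quotient_imp_subset[OF equiv_linked C] p by blast
  then have *: "fst p \<preceq> snd p" "fst p \<in> V" "snd p \<in> V"
    using optimal_matching[OF opt] by (auto simp: matching_def)
  then have "fst p \<in> sweep C" "snd p \<in> sweep C"
    using p le_refl by (auto simp: sweep_def)
  then show "level f C (fst p) = 1" "level f C (snd p) = 0"
    using class_violated[OF opt C p] p * le_refl by (auto simp: level_def)
qed

section \<open>Bounds on the distance to monotonicity\<close>

lemma ex_monotone_agreeing:
  assumes mono: "\<And>u v. u \<in> V - U \<Longrightarrow> v \<in> V - U \<Longrightarrow> u \<preceq> v \<Longrightarrow> f u \<le> (f v :: real)"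
  shows "\<exists>h. monotone_on V (\<preceq>) (\<le>) h \<and> (\<forall>x\<in>V - U. h x = f x)"
proof -
  \<comment> \<open>The extension takes the maximum of \<open>f\<close> over the kept vertices below
    \<open>x\<close>. The global minimum makes \<open>B x\<close> nonempty without affecting that
    maximum.\<close>
  define B where "B x = insert (Min (f ` V)) (f ` {u \<in> V - U. u \<preceq> x})" for x
  have fin: "finite (B x)" for x using finite_V by (simp add: B_def)
  have "monotone_on V (\<preceq>) (\<le>) (\<lambda>x. Max (B x))"
    by (intro monotone_onI Max_mono fin) (auto simp: B_def intro: le_trans)
  moreover have "Max (B x) = f x" if "x \<in> V - U" for x
    using that finite_V mono le_refl by (intro Max_eqI fin) (auto simp: B_def)
  ultimately show ?thesis by blast
qed

text \<open>On each pair of \<open>C\<close> the level function drops from 1 to 0, so a monotone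
  \<open>h\<close> must differ from it at an endpoint.\<close>

lemma card_class_le_card_diff:
  assumes opt: "optimal f M" and C: "C \<in> M // linked M" and h: "monotone_on V (\<preceq>) (\<le>) h"
  shows "card C \<le> card {x \<in> V. level f C x \<noteq> h x}"
proof -
  let ?g = "level f C"
  have CM: "C \<subseteq> M" using in_quotient_imp_subset[OF equiv_linked C] .
  have M: "matching M" using opt by (rule optimal_matching)
  define e where "e p = (if ?g (fst p) \<noteq> h (fst p) then fst p else snd p)" for p
  have "e ` C \<subseteq> {x \<in> V. ?g x \<noteq> h x}"
  proof
    fix x assume "x \<in> e ` C"
    then obtain p where p: "p \<in> C" "x = e p" by blast
    have *: "fst p \<preceq> snd p" "fst p \<in> V" "snd p \<in> V"
      using M CM p(1) by (auto simp: matching_def)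
    then have "h (fst p) \<le> h (snd p)" using h by (simp add: monotone_on_def)
    then show "x \<in> {x \<in> V. ?g x \<noteq> h x}"
      using level_endpoints[OF opt C p(1)] p(2) * by (auto simp: e_def)
  qed
  moreover have "inj_on e C"
  proof (rule inj_onI)
    fix p q assume pq: "p \<in> C" "q \<in> C" "e p = e q"
    \<comment> \<open>Lower endpoints have level 1 and upper ones level 0, so the pairs of
      \<open>C\<close> are vertex-disjoint and no disagreement is counted twice.\<close>
    have "fst p \<noteq> snd q" "fst q \<noteq> snd p"
      using level_endpoints[OF opt C pq(1)] level_endpoints[OF opt C pq(2)] by auto
    then have "fst p = fst q \<or> snd p = snd q"
      using pq(3) by (auto simp: e_def split: if_split_asm)
    then show "p = q" using M CM pq(1,2) by (auto simp: matching_def dest: inj_onD)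
  qed
  ultimately show ?thesis
    using finite_V by (intro card_inj_on_le[of e]) auto
qed

lemma ex_monotone_near:
  assumes opt: "optimal f M"
  shows "\<exists>h. monotone_on V (\<preceq>) (\<le>) h \<and> card {x \<in> V. f x \<noteq> h x} \<le> 2 * card M"
proof -
  let ?U = "fst ` M \<union> snd ` M"
  have fin: "finite M" using opt optimal_matching matching_finite by blast
  obtain h where h: "monotone_on V (\<preceq>) (\<le>) h" "\<forall>x\<in>V - ?U. h x = f x"
    using ex_monotone_agreeing[of ?U f] optimal_maximal[OF opt] by blast
  have "card {x \<in> V. f x \<noteq> h x} \<le> card ?U"
  proof (rule card_mono)
    show "{x \<in> V. f x \<noteq> h x} \<subseteq> ?U"
      using h(2) by (metis (mono_tags, lifting) DiffI mem_Collect_eq subsetI)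
  qed (use fin in simp)
  also have "\<dots> \<le> card (fst ` M) + card (snd ` M)" by (rule card_Un_le)
  also have "\<dots> \<le> 2 * card M"
    using card_image_le[OF fin, of fst] card_image_le[OF fin, of snd] by simp
  finally show ?thesis using h(1) by blast
qed

lemma sum_card_classes:
  assumes "finite M"
  shows "(\<Sum>C\<in>M // linked M. card C) = card M"
proof -
  have "card (\<Union> (M // linked M)) = (\<Sum>C\<in>M // linked M. card C)"
  proof (rule card_Union_disjoint)
    show "disjoint (M // linked M)"
      using quotient_disj[OF equiv_linked] by (blast intro: disjointI)
    show "finite C" if "C \<in> M // linked M" for C
      using finite_subset[OF in_quotient_imp_subset[OF equiv_linked that] assms] .
  qed
  then show ?thesis by (simp add: Union_quotient[OF equiv_linked])
qed

end

section \<open>The decomposition\<close>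

context fin_dag
begin

lemma finite_preorder_dag_le: "finite_preorder (pverts G) (dag_le G)"
  using reachable_trans by unfold_locales (auto simp: dag_le_def pair_finite_verts)

lemma mono_dist_le: "dag_mono G h \<Longrightarrow> mono_dist G g \<le> diff_fraction G g h"
  unfolding mono_dist_def using mono_dist_values by (intro Min_le) auto

lemma le_mono_dist: "(\<And>h. dag_mono G h \<Longrightarrow> c \<le> diff_fraction G g h) \<Longrightarrow> c \<le> mono_dist G g"
  unfolding mono_dist_def using mono_dist_values by (intro Min.boundedI) auto

end

lemma induced_subgraph_restrict:
  assumes "pair_wf_digraph G" "W \<subseteq> pverts G"
  shows "induced_subgraph (with_proj \<lparr>pverts = W, parcs = parcs G \<inter> W \<times> W\<rparr>) (with_proj G)"
proof -
  interpret pair_wf_digraph G by fact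
  have "wf_digraph (with_proj \<lparr>pverts = W, parcs = parcs G \<inter> W \<times> W\<rparr>)"
    by (auto simp: wf_digraph_def)
  then show ?thesis
    using assms(2) wf_digraph_axioms
    by (auto simp: induced_subgraph_def subgraph_def compatible_def)
qed

theorem theorem1p3:
  fixes G :: "'a pair_pre_digraph" and f :: "'a \<Rightarrow> real"
  assumes "fin_dag G" and "\<not> dag_mono G f"
  shows "\<exists>k\<ge>1. \<exists>(fs :: nat \<Rightarrow> 'a \<Rightarrow> real) (H :: nat \<Rightarrow> 'a pair_pre_digraph).
      (\<forall>i\<in>{1..k}. \<forall>x\<in>pverts G. fs i x \<in> {0, 1}) \<and>
      (\<forall>i\<in>{1..k}. induced_subgraph (with_proj (H i)) (with_proj G)) \<and>
      disjoint_family_on (\<lambda>i. pverts (H i)) {1..k} \<and>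
      2 * (\<Sum>i=1..k. mono_dist G (fs i)) \<ge> mono_dist G f \<and>
      (\<forall>i\<in>{1..k}. violated G (fs i) \<subseteq> violated G f \<inter> parcs (H i))"
proof -
  interpret fin_dag G by fact
  interpret P: finite_preorder "pverts G" "dag_le G" by (rule finite_preorder_dag_le)
  obtain M where opt: "P.optimal f M" using P.ex_optimal by blast
  have fin: "finite M" using P.optimal_matching[OF opt] P.matching_finite by blast
  \<comment> \<open>For empty \<open>M\<close> maximality would apply to all comparable pairs and
    make \<open>f\<close> monotone.\<close>
  have "M \<noteq> {}"
    using assms(2) P.optimal_maximal[OF opt] by (auto simp: dag_mono_def monotone_on_def)
  let ?Q = "M // P.linked M"
  have finQ: "finite ?Q" using fin equiv_type[OF P.equiv_linked] by (rule finite_quotient)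
  have "?Q \<noteq> {}" using \<open>M \<noteq> {}\<close> by (simp add: quotient_is_empty)
  obtain c where c: "bij_betw c {1..card ?Q} ?Q"
    using ex_bij_betw_nat_finite_1[OF finQ] by blast
  have cQ: "c i \<in> ?Q" if "i \<in> {1..card ?Q}" for i
    using c that by (auto simp: bij_betw_def)
  let ?n = "real (card (pverts G))"
  let ?fs = "\<lambda>i. P.level f (c i)"
  let ?W = "\<lambda>i. P.sweep (c i)"
  let ?H = "\<lambda>i. \<lparr>pverts = ?W i, parcs = parcs G \<inter> ?W i \<times> ?W i\<rparr>"
  have "card ?Q \<ge> 1" using finQ \<open>?Q \<noteq> {}\<close> by (simp add: Suc_le_eq card_gt_0_iff)
  moreover have "\<forall>i\<in>{1..card ?Q}. \<forall>x\<in>pverts G. ?fs i x \<in> {0, 1}"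
    by (simp add: P.level_def)
  moreover have "\<forall>i\<in>{1..card ?Q}. induced_subgraph (with_proj (?H i)) (with_proj G)"
    by (intro ballI induced_subgraph_restrict pair_wf_digraph_axioms) (auto simp: P.sweep_def)
  moreover have "disjoint_family_on (\<lambda>i. pverts (?H i)) {1..card ?Q}"
    unfolding disjoint_family_on_def
  proof (intro ballI impI)
    fix i j assume ij: "i \<in> {1..card ?Q}" "j \<in> {1..card ?Q}" "i \<noteq> j"
    then have "c i \<noteq> c j" using c by (auto simp: bij_betw_def dest: inj_onD)
    then show "pverts (?H i) \<inter> pverts (?H j) = {}"
      using P.sweep_disjoint[OF cQ[OF ij(1)] cQ[OF ij(2)]] by auto
  qed
  moreover have "2 * (\<Sum>i=1..card ?Q. mono_dist G (?fs i)) \<ge> mono_dist G f"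
  proof -
    obtain h where h: "dag_mono G h" "card {x \<in> pverts G. f x \<noteq> h x} \<le> 2 * card M"
      using P.ex_monotone_near[OF opt] by (auto simp: dag_mono_def)
    have "real (card {x \<in> pverts G. f x \<noteq> h x}) \<le> real (2 * card M)"
      using h(2) by (rule of_nat_mono)
    then have "diff_fraction G f h \<le> real (2 * card M) / ?n"
      unfolding diff_fraction_def by (rule divide_right_mono) simp
    then have "mono_dist G f \<le> real (2 * card M) / ?n"
      using mono_dist_le[OF h(1), of f] by linarith
    \<comment> \<open>The classes partition \<open>M\<close>; the factor 2 counts both endpoints of
      each pair.\<close>
    also have "\<dots> = 2 * (\<Sum>C\<in>?Q. real (card C) / ?n)"
      by (simp add: P.sum_card_classes[OF fin, symmetric] sum_divide_distrib[symmetric])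
    also have "(\<Sum>C\<in>?Q. real (card C) / ?n) = (\<Sum>i=1..card ?Q. real (card (c i)) / ?n)"
      by (rule sum.reindex_bij_betw[OF c, symmetric])
    also have "\<dots> \<le> (\<Sum>i=1..card ?Q. mono_dist G (?fs i))"
    proof (intro sum_mono le_mono_dist)
      fix i h assume "i \<in> {1..card ?Q}" "dag_mono G h"
      then show "real (card (c i)) / ?n \<le> diff_fraction G (?fs i) h"
        unfolding diff_fraction_def dag_mono_def
        using P.card_class_le_card_diff[OF opt cQ] by (intro divide_right_mono of_nat_mono) auto
    qed
    finally show ?thesis by simp
  qed
  moreover have "\<forall>i\<in>{1..card ?Q}. violated G (?fs i) \<subseteq> violated G f \<inter> parcs (?H i)"
  proof (intro ballI subsetI)
    fix i e assume "e \<in> violated G (?fs i)"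
    then obtain x y where e: "e = (x, y)" "(x, y) \<in> parcs G" "?fs i x > ?fs i y"
      by (auto simp: violated_def)
    then have "x \<in> pverts G" "y \<in> pverts G" "dag_le G x y"
      using in_arcsD1 in_arcsD2 reachable_adjI by (auto simp: dag_le_def)
    then have "x \<in> ?W i \<and> y \<in> ?W i \<and> f x > f y"
      using P.level_decreasing e(3) by blast
    then show "e \<in> violated G f \<inter> parcs (?H i)" using e by (auto simp: violated_def)
  qed
  ultimately show ?thesis by (intro exI[of _ "card ?Q"] conjI exI[of _ ?fs] exI[of _ ?H])
qed

end
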